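(* There exist a minimal, non-uniquely ergodic interval exchange transformation $T:[0,1)\to[0,1)$ and a constant $c>0$ such that $\inf_{n>0} n\,|T^n x-x|>c$ for all $x\in[0,1)$.
   Context: An interval exchange transformation (IET) is a bijection $T:[0,1)\to[0,1)$ for which there is a partition of $[0,1)$ into finitely many half-open intervals $[a,b)$ such that $T$ restricted to each of them is a translation. $T$ is minimal if every orbit $\{T^n x:n\in\mathbb{Z}\}$ is dense in $[0,1)$. $T$ is uniquely ergodic if it has exactly one invariant Borel probability measure. The infimum is over positive integers $n$. *)

theory Defs
  imports "HOL-Probability.Probability"
begin

text \<open>Maps of \<open>[0,1)\<close> are functions on the reals of which only the values on \<open>{0..<1}\<close>
  matter. Members of a \<^const>\<open>partition_on\<close> are nonempty, so \<open>a < b\<close> is implied below.\<close>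

definition interval_exchange :: "(real \<Rightarrow> real) \<Rightarrow> bool" where
  "interval_exchange T \<longleftrightarrow>
     bij_betw T {0..<1} {0..<1} \<and>
     (\<exists>P. finite P \<and> partition_on {0..<1} P \<and>
          (\<forall>I\<in>P. (\<exists>a b. I = {a..<b}) \<and> (\<exists>t. \<forall>x\<in>I. T x = x + t)))"

definition int_iterate :: "(real \<Rightarrow> real) \<Rightarrow> int \<Rightarrow> real \<Rightarrow> real" where
  "int_iterate T n =
     (if n \<ge> 0 then T ^^ nat n else inv_into {0..<1} T ^^ nat (- n))"

definition minimal_map :: "(real \<Rightarrow> real) \<Rightarrow> bool" where
  "minimal_map T \<longleftrightarrow>
     (\<forall>x\<in>{0..<1}. {0..<1} \<subseteq> closure {int_iterate T n x |n. n \<in> UNIV})"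

definition invariant_borel_prob :: "(real \<Rightarrow> real) \<Rightarrow> real measure \<Rightarrow> bool" where
  "invariant_borel_prob T M \<longleftrightarrow>
     prob_space M \<and> sets M = sets (restrict_space borel {0..<1}) \<and>
     T \<in> measurable M M \<and> distr M M T = M"

definition uniquely_ergodic :: "(real \<Rightarrow> real) \<Rightarrow> bool" where
  "uniquely_ergodic T \<longleftrightarrow> (\<exists>!M. invariant_borel_prob T M)"

end

theory Submission
  imports Defs "HOL-Computational_Algebra.Primes"
begin

text \<open>Let \<open>\<alpha> = \<surd>2 - 1\<close>. Every skew product of the rotation by \<open>-\<alpha>\<close> with the group \<open>{1,-1}\<close>
  over a step function \<open>F\<close> is an interval exchange \<open>T\<close> of \<open>[0,1)\<close>, and
  \<open>2 (T\<^sup>n y - y) + n \<alpha>\<close> is an integer, so the recurrence bound is bad approximability of \<open>\<alpha>\<close>.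
  Choose \<open>\<delta>\<^sub>k = \<alpha>^(k\<^sup>2 + k + 1) = q\<^sub>k \<alpha> - p\<^sub>k\<close> and let \<open>F\<close> be the product of the signs that jump at 0
  and at the sum of \<open>\<delta>\<^sub>k\<close> over the even \<open>k\<close>, over the odd \<open>k\<close>, and over all \<open>k\<close> respectively.
  None of the three sums is on the orbit of 0, so the jump of \<open>F\<close> at 0 is never cancelled in the
  Birkhoff products, and \<open>T\<close> is minimal. Passing from one partial sum to the next changes \<open>F\<close> by the
  coboundary of a function that differs from 1 only on a set of measure at most \<open>\<alpha>\<^sup>k\<close>.
  By Borel-Cantelli \<open>F\<close> is almost everywhere a coboundary \<open>H(x) H(x - \<alpha>)\<close>,
  and the graphs of \<open>H\<close> and \<open>-H\<close> carry two invariant measures.\<close>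

section \<open>Diophantine properties of \<open>\<surd>2 - 1\<close>\<close>

lemma frac_eq_iff_diff_Ints: "frac x = frac y \<longleftrightarrow> x - y \<in> \<int>" for x y :: real
proof
  assume "frac x = frac y"
  then show "x - y \<in> \<int>" by (metis frac_eqE Ints_of_int add_diff_cancel_left')
next
  assume "x - y \<in> \<int>"
  then show "frac x = frac y" using frac_add_int_right[of "x - y" y] by simp
qed

lemma frac_diff_cong: "frac x = frac y \<Longrightarrow> frac (x - t) = frac (y - t)" for x y t :: real
  by (simp add: frac_eq_iff_diff_Ints)

lemma frac_frac_diff [simp]: "frac (frac x - t) = frac (x - t)" for x t :: real
  by (rule frac_diff_cong) simp

definition alpha :: real where "alpha = sqrt 2 - 1"

lemma alpha_sq: "alpha * alpha = 1 - 2 * alpha"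
  by (simp add: alpha_def algebra_simps)

lemma alpha_gt_0: "0 < alpha" by (simp add: alpha_def)

lemma alpha_lt_half: "2 * alpha < 1"
proof -
  have "sqrt 2 < sqrt ((3/2)^2)" by (rule real_sqrt_less_mono) (simp add: power2_eq_square)
  then show ?thesis by (simp add: alpha_def)
qed

text \<open>The multiplicity of 2 is even in a nonzero square and odd in twice such a
  square.\<close>

lemma two_times_square_not_square:
  fixes n k :: int
  assumes "n \<noteq> 0" shows "k^2 \<noteq> 2 * n^2"
proof
  assume eq: "k^2 = 2 * n^2"
  then have "k \<noteq> 0" using assms by auto
  have "multiplicity 2 (k^2) = 2 * multiplicity 2 k"
    using \<open>k \<noteq> 0\<close> by (simp add: prime_elem_multiplicity_power_distrib)
  moreover have "multiplicity 2 (2 * n^2) = 1 + 2 * multiplicity 2 n"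
    using assms by (simp add: prime_elem_multiplicity_mult_distrib prime_elem_multiplicity_power_distrib)
  ultimately have "2 * multiplicity 2 k = 1 + 2 * multiplicity 2 n"
    unfolding eq by simp
  then show False by presburger
qed

text \<open>The product of \<open>n \<alpha> + m\<close> with its conjugate is a nonzero integer.\<close>

lemma alpha_badly_approximable:
  fixes n m :: int
  assumes "n \<noteq> 0"
  shows "1 / (4 * \<bar>real_of_int n\<bar>) \<le> \<bar>n * alpha + m\<bar>"
proof (cases "\<bar>n * alpha + m\<bar> \<le> 1")
  case False
  have "1 / (4 * \<bar>real_of_int n\<bar>) \<le> 1" using assms by (simp add: field_simps)
  then show ?thesis using False by linarith
next
  case True
  \<comment> \<open>\<open>?y\<close> is the conjugate of \<open>?x\<close>, since
    \<open>alpha\<close> has the conjugate \<open>- sqrt 2 - 1\<close>, which is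
    \<open>- (alpha + 2)\<close>.\<close>
  let ?x = "n * alpha + m" and ?y = "m - n * (alpha + 2)"
  have "?x * ?y = m^2 - 2 * n * m - n^2 * (alpha * alpha + 2 * alpha)"
    by (simp add: algebra_simps power2_eq_square)
  also have "\<dots> = of_int (m^2 - 2 * n * m - n^2)" by (simp add: alpha_sq)
  finally have prod: "?x * ?y = of_int (m^2 - 2 * n * m - n^2)" .
  \<comment> \<open>Completing the square, the norm is \<open>(m - n)^2 - 2 * n^2\<close>.\<close>
  have "(m - n)^2 \<noteq> 2 * n^2" by (rule two_times_square_not_square[OF assms])
  then have "m^2 - 2 * n * m - n^2 \<noteq> 0" by (simp add: power2_eq_square algebra_simps)
  then have "1 \<le> \<bar>?x * ?y\<bar>" unfolding prod by linarith
  then have ge1: "1 \<le> \<bar>?x\<bar> * \<bar>?y\<bar>" by (simp add: abs_mult)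
  have n1: "1 \<le> \<bar>real_of_int n\<bar>" using assms by linarith
  \<comment> \<open>The factor \<open>2 * alpha + 2\<close> is below 3, and \<open>?x\<close> is at
    most 1, hence at most \<open>n\<close>, in absolute value: this gives the constant 1 + 3 =
    4.\<close>
  have "?y = ?x - n * (2 * alpha + 2)" by (simp add: algebra_simps)
  then have "\<bar>?y\<bar> \<le> \<bar>?x\<bar> + \<bar>real_of_int n\<bar> * (2 * alpha + 2)"
    using alpha_gt_0 abs_triangle_ineq4[of ?x "n * (2 * alpha + 2)"] by (simp add: abs_mult)
  also have "\<dots> \<le> \<bar>real_of_int n\<bar> + \<bar>real_of_int n\<bar> * 3"
    using True n1 alpha_lt_half by (intro add_mono mult_left_mono) auto
  finally have "\<bar>?y\<bar> \<le> 4 * \<bar>real_of_int n\<bar>" by simp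
  then have "\<bar>?x\<bar> * \<bar>?y\<bar> \<le> \<bar>?x\<bar> * (4 * \<bar>real_of_int n\<bar>)" by (intro mult_left_mono) auto
  then have "1 \<le> \<bar>?x\<bar> * (4 * \<bar>real_of_int n\<bar>)" using ge1 by linarith
  then show ?thesis using n1 by (simp add: divide_le_eq)
qed

lemma alpha_multiple_not_Ints: "n \<noteq> 0 \<Longrightarrow> of_int n * alpha \<notin> \<int>"
proof
  assume n: "n \<noteq> 0" and "of_int n * alpha \<in> \<int>"
  then obtain m where "of_int n * alpha = of_int m" by (auto elim: Ints_cases)
  then have "1 / (4 * \<bar>real_of_int n\<bar>) \<le> 0"
    using alpha_badly_approximable[OF n, of "-m"] by simp
  then show False using n by (simp add: divide_le_0_iff)
qed

lemma alpha_notin_Rats: "alpha \<notin> \<rat>"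
proof
  assume "alpha \<in> \<rat>"
  then obtain p q :: int where "q \<noteq> 0" "alpha = of_int p / of_int q"
    by (metis Rats_cases' less_irrefl)
  then have "of_int q * alpha = of_int p" by (simp add: field_simps)
  then have "of_int q * alpha \<in> \<int>" by (metis Ints_of_int)
  then show False using alpha_multiple_not_Ints \<open>q \<noteq> 0\<close> by blast
qed

text \<open>Kronecker's theorem for the forward orbit of \<open>x\<close> under the rotation by
  \<open>- alpha\<close>.\<close>

lemma ex_alpha_orbit_between:
  fixes x :: real
  assumes "lo < hi"
  shows "\<exists>(l::nat) (m::int). 0 < l \<and> lo < x - real l * alpha + of_int m \<and> x - real l * alpha + of_int m < hi"
proof -
  have "- alpha \<notin> \<rat>" using alpha_notin_Rats by simp
  moreover have "0 < (hi - lo) / 2" using assms by simp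
  ultimately obtain h k :: int where h: "k > 0"
    "\<bar>of_int k * (- alpha) - of_int h - ((lo + hi) / 2 - x)\<bar> < (hi - lo) / 2"
    by (rule sequence_of_fractional_parts_is_dense)
  have "lo < x - nat k * alpha + of_int (- h) \<and> x - nat k * alpha + of_int (- h) < hi"
    using h unfolding abs_less_iff by (simp add: field_simps)
  moreover have "nat k > 0" using h by simp
  ultimately show ?thesis by blast
qed

text \<open>Powers of \<open>alpha\<close> are integral combinations of \<open>alpha\<close> and 1;
  odd exponents give these signs of the coefficients. The conjugate equation bounds \<open>q\<close>
  by \<open>(alpha + 2) ^ (2 * j + 1)\<close>, and \<open>(alpha + 2) * alpha = 1\<close>.\<close>

lemma alpha_odd_power:
  "\<exists>(p::nat) (q::nat). alpha ^ (2 * j + 1) = q * alpha - p \<and> q * alpha ^ (2 * j + 1) \<le> 1"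
proof -
  \<comment> \<open>The second equation is the negated conjugate of the first; all its terms are
    nonnegative.\<close>
  have "\<exists>(p::nat) (q::nat). alpha ^ (2 * j + 1) = q * alpha - p \<and> (alpha + 2) ^ (2 * j + 1) = q * (alpha + 2) + p"
  proof (induction j)
    case 0
    show ?case by (rule exI[of _ 0], rule exI[of _ 1]) simp
  next
    case (Suc j)
    then obtain p q :: nat where IH: "alpha ^ (2 * j + 1) = q * alpha - p"
      "(alpha + 2) ^ (2 * j + 1) = q * (alpha + 2) + p" by blast
    have sq: "(alpha + 2) * (alpha + 2) = 1 + 2 * (alpha + 2)"
      using alpha_sq by (simp add: algebra_simps)
    have "alpha ^ (2 * Suc j + 1) = (q * alpha - p) * (alpha * alpha)"
      unfolding IH(1)[symmetric] by (simp add: ac_simps)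
    also have "\<dots> = (q * alpha - p) * (1 - 2 * alpha)" by (simp only: alpha_sq)
    also have "\<dots> = q * alpha - p - 2 * q * (alpha * alpha) + 2 * p * alpha"
      by (simp add: algebra_simps)
    also have "\<dots> = real (5 * q + 2 * p) * alpha - real (p + 2 * q)"
      unfolding alpha_sq by (simp add: algebra_simps)
    finally have 1: "alpha ^ (2 * Suc j + 1) = real (5 * q + 2 * p) * alpha - real (p + 2 * q)" .
    have "(alpha + 2) ^ (2 * Suc j + 1) = (alpha + 2) ^ (2 * j + 1) * ((alpha + 2) * (alpha + 2))"
      by (simp add: ac_simps)
    also have "\<dots> = (q * (alpha + 2) + p) * (1 + 2 * (alpha + 2))" by (simp only: sq IH(2))
    also have "\<dots> = q * (alpha + 2) + p + 2 * q * ((alpha + 2) * (alpha + 2)) + 2 * p * (alpha + 2)"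
      by (simp add: algebra_simps)
    also have "\<dots> = real (5 * q + 2 * p) * (alpha + 2) + real (p + 2 * q)"
      unfolding sq by (simp add: algebra_simps)
    finally have 2: "(alpha + 2) ^ (2 * Suc j + 1) = real (5 * q + 2 * p) * (alpha + 2) + real (p + 2 * q)" .
    show ?case using 1 2 by blast
  qed
  then obtain p q :: nat where pq: "alpha ^ (2 * j + 1) = q * alpha - p"
    "(alpha + 2) ^ (2 * j + 1) = q * (alpha + 2) + p" by blast
  have "real q \<le> q * (alpha + 2) + p" using alpha_gt_0 by (simp add: algebra_simps add_increasing)
  then have "q * alpha ^ (2 * j + 1) \<le> (alpha + 2) ^ (2 * j + 1) * alpha ^ (2 * j + 1)"
    unfolding pq(2)[symmetric] using alpha_gt_0 by (intro mult_right_mono) auto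
  also have "\<dots> = ((alpha + 2) * alpha) ^ (2 * j + 1)" by (simp only: power_mult_distrib)
  also have "(alpha + 2) * alpha = 1" using alpha_sq by (simp add: algebra_simps)
  finally show ?thesis using pq by auto
qed

section \<open>Subsums of a lacunary series\<close>

text \<open>The exponent is odd, so that \<open>alpha_odd_power\<close> applies, and quadratic, so
  that the ratios of consecutive terms tend to 0.\<close>

definition delta :: "nat \<Rightarrow> real" where "delta k = alpha ^ (k * k + k + 1)"

lemma ex_delta_multiple: "\<exists>q::nat. q * alpha - delta k \<in> \<int> \<and> q * delta k \<le> 1"
proof -
  have "even (k * k + k)" by simp
  then obtain j where j: "k * k + k = 2 * j" by blast
  obtain p q :: nat where pq: "alpha ^ (2 * j + 1) = q * alpha - p" "q * alpha ^ (2 * j + 1) \<le> 1"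
    using alpha_odd_power by blast
  have "delta k = alpha ^ (2 * j + 1)" unfolding delta_def j ..
  then show ?thesis using pq by (intro exI[of _ q]) auto
qed

definition mult_of_delta :: "nat \<Rightarrow> nat" where
  "mult_of_delta k = (SOME q. q * alpha - delta k \<in> \<int> \<and> q * delta k \<le> 1)"

lemma mult_of_delta:
  "mult_of_delta k * alpha - delta k \<in> \<int>" "mult_of_delta k * delta k \<le> 1"
  using someI_ex[OF ex_delta_multiple] unfolding mult_of_delta_def by blast+

lemma delta_gt_0: "0 < delta k" by (simp add: delta_def alpha_gt_0)

lemma delta_Suc: "delta (Suc k) = delta k * alpha ^ (2 * k + 2)"
  unfolding delta_def power_add[symmetric] by (rule arg_cong[of _ _ "(^) alpha"]) simp

lemma delta_le_power: "delta k \<le> alpha ^ k"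
  unfolding delta_def using alpha_gt_0 alpha_lt_half by (intro power_decreasing) auto

lemma delta_add_le: "delta (k + j) \<le> delta k * (1/2) ^ j"
proof (induction j)
  case (Suc j)
  have "alpha ^ (2 * (k + j) + 2) \<le> alpha ^ 1"
    using alpha_gt_0 alpha_lt_half by (intro power_decreasing) auto
  then have "alpha ^ (2 * (k + j) + 2) \<le> 1/2" using alpha_lt_half by simp
  then have "delta (k + Suc j) \<le> delta (k + j) * (1/2)"
    unfolding add_Suc_right delta_Suc using delta_gt_0[of "k + j"]
    by (intro mult_left_mono) auto
  also have "\<dots> \<le> delta k * (1/2) ^ j * (1/2)" using Suc by simp
  finally show ?case by simp
qed simp

text \<open>A set \<open>S\<close> of indices selects the subsum of \<open>\<Sum>\<^sub>j \<delta>\<^sub>j\<close> over \<open>S\<close>. Its partial sums lie on the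
  orbit \<open>\<nat>\<alpha>\<close> modulo 1, the limit does not when \<open>S\<close> is infinite.\<close>

definition pos :: "nat set \<Rightarrow> nat \<Rightarrow> real" where
  "pos S k = (\<Sum>j<k. if j \<in> S then delta j else 0)"

definition mult_of_pos :: "nat set \<Rightarrow> nat \<Rightarrow> nat" where
  "mult_of_pos S k = (\<Sum>j<k. if j \<in> S then mult_of_delta j else 0)"

definition pos_lim :: "nat set \<Rightarrow> real" where
  "pos_lim S = (\<Sum>j. if j \<in> S then delta j else 0)"

lemma pos_0 [simp]: "pos S 0 = 0" by (simp add: pos_def)

lemma pos_Suc: "pos S (Suc k) = pos S k + (if k \<in> S then delta k else 0)"
  by (simp add: pos_def)

lemma mult_of_pos: "mult_of_pos S k * alpha - pos S k \<in> \<int>"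
proof (induction k)
  case (Suc k)
  show ?case
  proof (cases "k \<in> S")
    case True
    have "(mult_of_pos S k * alpha - pos S k) + (mult_of_delta k * alpha - delta k) \<in> \<int>"
      using Suc mult_of_delta(1) by (rule Ints_add)
    then show ?thesis using True by (simp add: mult_of_pos_def pos_def algebra_simps)
  qed (use Suc in \<open>simp add: mult_of_pos_def pos_def\<close>)
qed (simp add: mult_of_pos_def)

text \<open>Inductively \<open>mult_of_pos S (Suc k) * delta k\<close> is at most 2, and passing to
  \<open>delta (Suc k)\<close> gains the factor \<open>alpha ^ (2 * k + 2)\<close>. The bound serves
  twice: it keeps the limits off the orbit and makes the exceptional sets of the towers
  summable.\<close>

lemma mult_of_pos_times_delta_le: "mult_of_pos S k * delta k \<le> alpha ^ k"
proof (induction k)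
  case (Suc k)
  have "mult_of_pos S (Suc k) * delta k \<le> mult_of_pos S k * delta k + mult_of_delta k * delta k"
    using delta_gt_0[of k] by (simp add: mult_of_pos_def algebra_simps)
  also have "\<dots> \<le> 1 + 1"
    using Suc mult_of_delta(2)[of k] power_le_one[of alpha k] alpha_gt_0 alpha_lt_half
    by (intro add_mono) auto
  finally have "mult_of_pos S (Suc k) * delta k * alpha ^ (2 * k + 2) \<le> 2 * alpha ^ (2 * k + 2)"
    using alpha_gt_0 by (intro mult_right_mono) auto
  also have "\<dots> = 2 * alpha * alpha ^ (2 * k + 1)" by simp
  also have "\<dots> \<le> 1 * alpha ^ (2 * k + 1)"
    using alpha_gt_0 alpha_lt_half by (intro mult_right_mono) auto
  also have "\<dots> \<le> alpha ^ Suc k"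
    unfolding mult_1 using alpha_gt_0 alpha_lt_half by (intro power_decreasing) auto
  finally show ?case by (simp add: delta_Suc mult.assoc)
qed (simp add: mult_of_pos_def)

lemma delta_tail_sums:
  "summable (\<lambda>j. if j + k \<in> S then delta (j + k) else 0)"
  "(\<Sum>j. if j + k \<in> S then delta (j + k) else 0) \<le> 2 * delta k"
proof -
  have le: "(if j + k \<in> S then delta (j + k) else 0) \<le> delta k * (1/2) ^ j" for j
    using delta_add_le[of k j] delta_gt_0[of k] by (simp add: add.commute)
  have sums: "(\<lambda>j. delta k * (1/2) ^ j) sums (delta k * 2)"
    using geometric_sums[of "1/2 :: real"] by (intro sums_mult) simp
  show s: "summable (\<lambda>j. if j + k \<in> S then delta (j + k) else 0)"
    by (rule summable_comparison_test'[OF sums_summable[OF sums]])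
       (use le in \<open>simp add: less_imp_le[OF delta_gt_0]\<close>)
  show "(\<Sum>j. if j + k \<in> S then delta (j + k) else 0) \<le> 2 * delta k"
    using suminf_le[OF le s sums_summable[OF sums]] sums_unique[OF sums] by simp
qed

lemma pos_lim_split:
  "pos_lim S = pos S k + (\<Sum>j. if j + k \<in> S then delta (j + k) else 0)"
  unfolding pos_lim_def pos_def
  using suminf_split_initial_segment[OF delta_tail_sums(1)[of 0 S, unfolded add_0_right], of k]
  by (simp add: add.commute)

lemma pos_le_pos_lim: "pos S k \<le> pos_lim S"
  unfolding pos_lim_split[of S k] using suminf_nonneg[OF delta_tail_sums(1)[of k S]]
  by (simp add: less_imp_le[OF delta_gt_0])

lemma pos_lim_le: "pos_lim S \<le> pos S k + 2 * delta k"
  unfolding pos_lim_split[of S k] using delta_tail_sums(2) by simp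

lemma pos_less_pos_lim:
  assumes "infinite S" shows "pos S k < pos_lim S"
proof -
  obtain i where "i \<in> S" "k \<le> i" using assms infinite_nat_iff_unbounded_le by blast
  then have "0 < (\<Sum>j. if j + k \<in> S then delta (j + k) else 0)"
    by (intro suminf_pos2[OF delta_tail_sums(1), of _ _ "i - k"]) (auto simp: less_imp_le delta_gt_0)
  then show ?thesis unfolding pos_lim_split[of S k] by simp
qed

lemma pos_lim_gt_0: "infinite S \<Longrightarrow> 0 < pos_lim S"
  using pos_less_pos_lim[of S 0] by simp

lemma pos_lim_lt_1: "pos_lim S < 1"
  using pos_lim_le[of S 0] alpha_lt_half by (simp add: delta_def)

lemma alpha_power_tendsto_0: "(\<lambda>k. alpha ^ k) \<longlonglongrightarrow> 0"
  using alpha_gt_0 alpha_lt_half by (intro LIMSEQ_power_zero) auto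

lemma pos_tendsto: "pos S \<longlonglongrightarrow> pos_lim S"
  unfolding pos_lim_def using summable_LIMSEQ[OF delta_tail_sums(1)[of 0 S, unfolded add_0_right]]
  by (simp add: pos_def[abs_def])

text \<open>The partial sums approximate the limit better than bad approximability of \<open>\<alpha>\<close> allows for
  a point of the orbit.\<close>

lemma pos_lim_not_on_orbit:
  fixes n :: int
  assumes "infinite S" shows "pos_lim S - n * alpha \<notin> \<int>"
proof
  assume n: "pos_lim S - n * alpha \<in> \<int>"
  have bound: "1 \<le> 8 * (\<bar>real_of_int n\<bar> + 1) * alpha ^ k" if "k \<ge> 1" for k
  proof -
    have "pos_lim S - n * alpha + (mult_of_pos S k * alpha - pos S k) \<in> \<int>"
      by (rule Ints_add[OF n mult_of_pos])
    then obtain m :: int where m: "pos_lim S - n * alpha + (mult_of_pos S k * alpha - pos S k) = m"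
      by (auto elim: Ints_cases)
    let ?N = "n - int (mult_of_pos S k)"
    have eq: "pos_lim S - pos S k = ?N * alpha + m" using m by (simp add: algebra_simps)
    have pos: "0 < pos_lim S - pos S k" using pos_less_pos_lim[OF assms] by simp
    have small: "pos_lim S - pos S k \<le> 2 * delta k" using pos_lim_le[of S k] by simp
    have "delta k \<le> alpha ^ k" by (rule delta_le_power)
    also have "alpha ^ k \<le> alpha ^ 1"
      using that alpha_gt_0 alpha_lt_half by (intro power_decreasing) auto
    finally have "2 * delta k < 1" using alpha_lt_half by simp
    \<comment> \<open>If \<open>?N\<close> were 0, the gap would be an integer strictly between 0
      and 1.\<close>
    then have "?N \<noteq> 0" using pos small eq by (intro notI) simp
    have "1 / (4 * \<bar>real_of_int ?N\<bar>) \<le> \<bar>?N * alpha + m\<bar>"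
      by (rule alpha_badly_approximable[OF \<open>?N \<noteq> 0\<close>])
    then have "1 / (4 * \<bar>real_of_int ?N\<bar>) \<le> 2 * delta k" using eq pos small by simp
    then have "1 \<le> 2 * delta k * (4 * \<bar>real_of_int ?N\<bar>)"
      using \<open>?N \<noteq> 0\<close> by (simp only: divide_le_eq) (simp split: if_splits)
    \<comment> \<open>After multiplication by \<open>delta k\<close>, the fixed \<open>n\<close> and
      the growing \<open>mult_of_pos S k\<close> both contribute
      O(\<open>alpha ^ k\<close>).\<close>
    also have "\<dots> \<le> 2 * delta k * (4 * (\<bar>real_of_int n\<bar> + mult_of_pos S k))"
      using delta_gt_0[of k] by (intro mult_left_mono) auto
    also have "\<dots> = 8 * (\<bar>real_of_int n\<bar> * delta k + mult_of_pos S k * delta k)"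
      by (simp add: algebra_simps)
    also have "\<dots> \<le> 8 * (\<bar>real_of_int n\<bar> * alpha ^ k + alpha ^ k)"
      using mult_of_pos_times_delta_le[of S k] delta_le_power[of k]
      by (intro mult_left_mono add_mono) auto
    finally show ?thesis by (simp add: algebra_simps)
  qed
  have "(\<lambda>k. 8 * (\<bar>real_of_int n\<bar> + 1) * alpha ^ k) \<longlonglongrightarrow> 8 * (\<bar>real_of_int n\<bar> + 1) * 0"
    by (intro tendsto_mult tendsto_const alpha_power_tendsto_0)
  then have "1 \<le> 8 * (\<bar>real_of_int n\<bar> + 1) * 0"
    by (rule tendsto_lowerbound) (use bound in \<open>auto intro!: eventually_sequentiallyI[of 1]\<close>)
  then show False by simp
qed

section \<open>The skew product\<close>

text \<open>Functions on the circle are written as 1-periodic functions of a real argument, so that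
  a rotation is a plain subtraction.\<close>

definition chi :: "real \<Rightarrow> real \<Rightarrow> real" where
  "chi u x = (if frac x < u then - 1 else 1)"

text \<open>All three factors change sign at 0; their number is odd, so the product changes sign
  there too.\<close>

definition cocycle :: "real \<Rightarrow> real" where
  "cocycle x = chi (pos_lim {k. even k}) x * chi (pos_lim {k. odd k}) x * chi (pos_lim UNIV) x"

text \<open>The skew product lives on pairs of a point of the circle and a sign. The pair \<open>(x, s)\<close>
  is encoded as the point \<open>x/2\<close> of \<open>[0,1/2)\<close> if \<open>s = 1\<close>, and as \<open>x/2 + 1/2\<close> if \<open>s = -1\<close>.\<close>

definition encode :: "real \<Rightarrow> real \<Rightarrow> real" where
  "encode x s = frac x / 2 + (1 - s) / 4"

definition half_sign :: "real \<Rightarrow> real" where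
  "half_sign y = (if y < 1/2 then 1 else - 1)"

definition skew :: "real \<Rightarrow> real" where
  "skew y = encode (2 * y - alpha) (half_sign y * cocycle (2 * y))"

lemma chi_cong: "frac x = frac y \<Longrightarrow> chi u x = chi u y"
  by (simp add: chi_def)

lemma cocycle_cong: "frac x = frac y \<Longrightarrow> cocycle x = cocycle y"
  unfolding cocycle_def by (metis chi_cong)

lemma chi_sign: "chi u x \<in> {1, - 1}" by (simp add: chi_def)

lemma chi_square [simp]: "chi u x * chi u x = 1" by (simp add: chi_def)

lemma sign_mult: "s \<in> {1, - 1} \<Longrightarrow> t \<in> {1, - 1} \<Longrightarrow> s * t \<in> {1, - 1}" for s t :: real
  by auto

lemma cocycle_sign: "cocycle x \<in> {1, - 1}"
  unfolding cocycle_def by (intro sign_mult chi_sign)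

lemma half_sign_sign: "half_sign x \<in> {1, - 1}" by (simp add: half_sign_def)

lemma encode_cong: "frac x = frac y \<Longrightarrow> encode x s = encode y s"
  by (simp add: encode_def)

lemma encode_in: "s \<in> {1, - 1} \<Longrightarrow> encode x s \<in> {0..<1}"
  using frac_ge_0[of x] frac_lt_1[of x] unfolding encode_def by (auto simp: field_simps)

lemma half_sign_encode: "s \<in> {1, - 1} \<Longrightarrow> half_sign (encode x s) = s"
  using frac_ge_0[of x] frac_lt_1[of x] unfolding encode_def half_sign_def
  by (auto simp del: frac_ge_0)

lemma frac_encode: "s \<in> {1, - 1} \<Longrightarrow> frac (2 * encode x s) = frac x"
  unfolding frac_eq_iff_diff_Ints by (auto simp: encode_def frac_def diff_divide_distrib)

lemma frac_double:
  assumes "y \<in> {0..<1}" shows "frac (2 * y) = 2 * y - (if y < 1/2 then 0 else 1 :: real)"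
  unfolding frac_unique_iff using assms by (auto split: if_splits)

lemma encode_double: "y \<in> {0..<1} \<Longrightarrow> encode (2 * y) (half_sign y) = y"
  by (simp add: encode_def half_sign_def frac_double diff_divide_distrib)

lemma encode_eqI:
  assumes "y \<in> {0..<1}" "frac (2 * y) = frac x" "half_sign y = s"
  shows "y = encode x s"
  using assms encode_double encode_cong by metis

lemma skew_in: "skew y \<in> {0..<1}"
  unfolding skew_def by (intro encode_in sign_mult half_sign_sign cocycle_sign)

lemma half_sign_skew: "half_sign (skew y) = half_sign y * cocycle (2 * y)"
  unfolding skew_def by (intro half_sign_encode sign_mult half_sign_sign cocycle_sign)

lemma frac_skew: "frac (2 * skew y) = frac (2 * y - alpha)"
  unfolding skew_def by (intro frac_encode sign_mult half_sign_sign cocycle_sign)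

lemma skew_encode:
  assumes "s \<in> {1, - 1}"
  shows "skew (encode x s) = encode (x - alpha) (s * cocycle x)"
  unfolding skew_def half_sign_encode[OF assms] cocycle_cong[OF frac_encode[OF assms]]
  by (intro encode_cong frac_diff_cong frac_encode assms)

lemma skew_bij: "bij_betw skew {0..<1} {0..<1}"
  unfolding bij_betw_def
proof
  show "inj_on skew {0..<1}"
  proof (rule inj_onI)
    fix y z :: real assume yz: "y \<in> {0..<1}" "z \<in> {0..<1}" "skew y = skew z"
    have "frac (2 * y - alpha) = frac (2 * z - alpha)" using yz(3) by (metis frac_skew)
    then have fr: "frac (2 * y) = frac (2 * z)" by (simp add: frac_eq_iff_diff_Ints)
    have "half_sign y * cocycle (2 * y) = half_sign z * cocycle (2 * z)"
      using yz(3) by (metis half_sign_skew)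
    then have "half_sign y = half_sign z"
      using cocycle_cong[OF fr] cocycle_sign[of "2 * z"] by auto
    then show "y = z" using encode_eqI[OF yz(1) fr] encode_double[OF yz(2)] by simp
  qed
  show "skew ` {0..<1} = {0..<1}"
  proof
    show "{0..<1} \<subseteq> skew ` {0..<1}"
    proof
      fix z :: real assume z: "z \<in> {0..<1}"
      \<comment> \<open>The preimage is found by rotating back and undoing the sign change, which is
        its own inverse.\<close>
      let ?s = "half_sign z * cocycle (2 * z + alpha)"
      have s: "?s \<in> {1, - 1}" by (intro sign_mult half_sign_sign cocycle_sign)
      have "skew (encode (2 * z + alpha) ?s) =
          encode (2 * z) (half_sign z * (cocycle (2 * z + alpha) * cocycle (2 * z + alpha)))"
        unfolding skew_encode[OF s] by (simp add: mult.assoc)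
      also have "cocycle (2 * z + alpha) * cocycle (2 * z + alpha) = 1"
        using cocycle_sign[of "2 * z + alpha"] by auto
      finally have "skew (encode (2 * z + alpha) ?s) = z" using encode_double[OF z] by simp
      then show "z \<in> skew ` {0..<1}" using encode_in[OF s] by (metis image_eqI)
    qed
  qed (use skew_in in blast)
qed

text \<open>The pieces are cut out by consecutive points of \<open>D\<close>. Comparing with
  \<open>d \<le> x\<close> rather than \<open>d < x\<close> makes them closed on the left and open
  on the right.\<close>

lemma interval_exchangeI:
  fixes T :: "real \<Rightarrow> real" and D :: "real set"
  assumes bij: "bij_betw T {0..<1} {0..<1}" and fin: "finite D"
    and trans: "\<And>x y. x \<in> {0..<1} \<Longrightarrow> y \<in> {0..<1} \<Longrightarrow> (\<And>d. d \<in> D \<Longrightarrow> d \<le> x \<longleftrightarrow> d \<le> y) \<Longrightarrow>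
      T x - x = T y - y"
  shows "interval_exchange T"
proof -
  \<comment> \<open>The added points 0 and 1 keep the sets under \<open>Max\<close> and
    \<open>Min\<close> nonempty.\<close>
  define E where "E = (D \<inter> {0..1}) \<union> {0, 1}"
  define lo where "lo = (\<lambda>x. Max {d \<in> E. d \<le> x})"
  define hi where "hi = (\<lambda>x. Min {d \<in> E. x < d})"
  define P where "P = (\<lambda>x. {lo x..<hi x}) ` {0..<1::real}"
  have finE: "finite E" using fin by (simp add: E_def)
  have lo: "lo x \<in> E \<and> lo x \<le> x" and hi: "hi x \<in> E \<and> x < hi x" if "x \<in> {0..<1}" for x
  proof -
    have "{d \<in> E. d \<le> x} \<noteq> {}" "{d \<in> E. x < d} \<noteq> {}" using that by (auto simp: E_def)
    then show "lo x \<in> E \<and> lo x \<le> x" "hi x \<in> E \<and> x < hi x"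
      using Max_in[of "{d \<in> E. d \<le> x}"] Min_in[of "{d \<in> E. x < d}"] finE
      unfolding lo_def hi_def by auto
  qed
  have same: "(d \<le> y) = (d \<le> x)" if "x \<in> {0..<1}" "y \<in> {lo x..<hi x}" "d \<in> E" for x y d
  proof (cases "d \<le> x")
    case True
    then have "d \<le> lo x" unfolding lo_def using finE that by (intro Max_ge) auto
    then show ?thesis using True that by auto
  next
    case False
    then have "hi x \<le> d" unfolding hi_def using finE that by (intro Min_le) auto
    then show ?thesis using False that by auto
  qed
  have in01: "y \<in> {0..<1}" if "x \<in> {0..<1}" "y \<in> {lo x..<hi x}" for x y
    using lo[OF that(1)] hi[OF that(1)] that by (auto simp: E_def)
  have self: "x \<in> {lo x..<hi x}" if "x \<in> {0..<1}" for x
    using lo[OF that] hi[OF that] by simp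
  have eqI: "{lo y..<hi y} = {lo x..<hi x}" if "x \<in> {0..<1}" "y \<in> {lo x..<hi x}" for x y
  proof -
    have "{d \<in> E. d \<le> y} = {d \<in> E. d \<le> x}" using same[OF that] by auto
    moreover have "{d \<in> E. y < d} = {d \<in> E. x < d}" using same[OF that] by (auto simp flip: not_le)
    ultimately show ?thesis by (simp add: lo_def hi_def)
  qed
  have "P \<subseteq> (\<lambda>(a, b). {a..<b}) ` (E \<times> E)"
  proof
    fix I assume "I \<in> P"
    then obtain x where "x \<in> {0..<1}" "I = {lo x..<hi x}" unfolding P_def by blast
    then show "I \<in> (\<lambda>(a, b). {a..<b}) ` (E \<times> E)"
      using lo[of x] hi[of x] by (intro image_eqI[of _ _ "(lo x, hi x)"]) auto
  qed
  then have finP: "finite P" using finE by (meson finite_SigmaI finite_imageI finite_subset)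
  have part: "partition_on {0..<1} P"
  proof (rule partition_onI)
    show "\<Union> P = {0..<1}" unfolding P_def using self in01 by blast
    show "disjnt p q" if pq: "p \<in> P" "q \<in> P" "p \<noteq> q" for p q
    proof (rule ccontr)
      assume "\<not> disjnt p q"
      then obtain z where "z \<in> p" "z \<in> q" by (auto simp: disjnt_def)
      moreover obtain x y where "x \<in> {0..<1}" "p = {lo x..<hi x}" "y \<in> {0..<1}" "q = {lo y..<hi y}"
        using pq(1,2) unfolding P_def by blast
      ultimately show False using pq(3) eqI[of x z] eqI[of y z] by simp
    qed
    show "{} \<notin> P" unfolding P_def using self by blast
  qed
  have piece: "(\<exists>a b. I = {a..<b}) \<and> (\<exists>t. \<forall>x\<in>I. T x = x + t)" if I: "I \<in> P" for I
  proof -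
    obtain x where x: "I = {lo x..<hi x}" "x \<in> {0..<1}" using I unfolding P_def by (rule imageE)
    have "T y = y + (T x - x)" if "y \<in> I" for y
    proof -
      have y2: "y \<in> {lo x..<hi x}" using that unfolding x(1) .
      have y1: "y \<in> {0..<1}" by (rule in01[OF x(2) y2])
      have "d \<le> y \<longleftrightarrow> d \<le> x" if "d \<in> D" for d
      proof (cases "d \<in> {0..1}")
        case True
        then show ?thesis using same[OF x(2) y2, of d] that by (simp add: E_def)
      next
        case False
        then show ?thesis using x(2) y1 by auto
      qed
      then have "T y - y = T x - x" by (intro trans[OF y1 x(2)])
      then show ?thesis by simp
    qed
    then have "\<exists>t. \<forall>x\<in>I. T x = x + t" by blast
    then show ?thesis using x(1) by blast
  qed
  show ?thesis unfolding interval_exchange_def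
    by (rule conjI[OF bij], rule exI[of _ P], intro conjI finP part ballI piece)
qed

lemma skew_interval_exchange: "interval_exchange skew"
proof (rule interval_exchangeI[OF skew_bij])
  \<comment> \<open>The rotation wraps around at \<open>alpha\<close>, the cocycle jumps at the
    three limits, and 1 yields the border 1/2 between the two sheets. Each point is needed once in
    either sheet.\<close>
  let ?U = "{alpha, 1, pos_lim {k. even k}, pos_lim {k. odd k}, pos_lim UNIV}"
  let ?D = "(\<lambda>u. u / 2) ` ?U \<union> (\<lambda>u. (u + 1) / 2) ` ?U"
  show "finite ?D" by simp
  fix x y :: real
  assume xy: "x \<in> {0..<1}" "y \<in> {0..<1}" and D: "\<And>d. d \<in> ?D \<Longrightarrow> d \<le> x \<longleftrightarrow> d \<le> y"
  have half: "x < 1/2 \<longleftrightarrow> y < 1/2" using D[of "1/2"] by auto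
  have less: "frac (2 * x) < u \<longleftrightarrow> frac (2 * y) < u" if "u \<in> ?U" for u
  proof -
    have "u / 2 \<in> ?D" "(u + 1) / 2 \<in> ?D" using that by blast+
    then have "u / 2 \<le> x \<longleftrightarrow> u / 2 \<le> y" "(u + 1) / 2 \<le> x \<longleftrightarrow> (u + 1) / 2 \<le> y"
      using D by blast+
    then show ?thesis using half unfolding frac_double[OF xy(1)] frac_double[OF xy(2)]
      by (auto simp: field_simps split: if_splits)
  qed
  have "chi u (2 * x) = chi u (2 * y)" if "u \<in> ?U" for u
    unfolding chi_def using less[OF that] by simp
  then have coc: "cocycle (2 * x) = cocycle (2 * y)" unfolding cocycle_def by simp
  have sgn: "half_sign x = half_sign y" using half by (simp add: half_sign_def)
  have fr: "frac (2 * z - alpha) = frac (2 * z) - alpha + (if frac (2 * z) < alpha then 1 else 0)" for z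
  proof -
    have "2 * z - alpha - (frac (2 * z) - alpha + (if frac (2 * z) < alpha then 1 else 0)) \<in> \<int>"
      by (simp add: frac_def)
    then show ?thesis
      unfolding frac_unique_iff using frac_ge_0[of "2 * z"] frac_lt_1[of "2 * z"] alpha_gt_0 alpha_lt_half
      by (simp del: frac_ge_0)
  qed
  have "frac (2 * x - alpha) - 2 * x = frac (2 * y - alpha) - 2 * y"
    unfolding fr using less[of alpha] half frac_double[OF xy(1)] frac_double[OF xy(2)] by simp
  then show "skew x - x = skew y - y"
    unfolding skew_def encode_def coc sgn by (simp add: field_simps)
qed

section \<open>Birkhoff products and the recurrence bound\<close>

definition birkhoff :: "nat \<Rightarrow> real \<Rightarrow> real" where
  "birkhoff n x = (\<Prod>j<n. cocycle (x - real j * alpha))"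

lemma birkhoff_cong:
  assumes "frac x = frac y" shows "birkhoff n x = birkhoff n y"
  unfolding birkhoff_def by (intro prod.cong refl cocycle_cong frac_diff_cong assms)

lemma birkhoff_add: "birkhoff (m + n) x = birkhoff m x * birkhoff n (x - real m * alpha)"
proof (induction n)
  case (Suc n)
  have "x - real (m + n) * alpha = x - real m * alpha - real n * alpha" by (simp add: algebra_simps)
  then have "cocycle (x - real (m + n) * alpha) = cocycle (x - real m * alpha - real n * alpha)"
    by (rule arg_cong)
  then show ?case using Suc unfolding birkhoff_def add_Suc_right prod.lessThan_Suc by simp
qed (simp add: birkhoff_def)

lemma skew_funpow_in: "y \<in> {0..<1} \<Longrightarrow> (skew ^^ n) y \<in> {0..<1}"
  by (cases n) (use skew_in in auto)

lemma frac_skew_funpow: "frac (2 * (skew ^^ n) y) = frac (2 * y - real n * alpha)"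
proof (induction n)
  case (Suc n)
  have "frac (2 * (skew ^^ Suc n) y) = frac (2 * y - real n * alpha - alpha)"
    using frac_diff_cong[OF Suc] by (simp add: frac_skew)
  then show ?case by (simp add: algebra_simps)
qed simp

lemma half_sign_skew_funpow: "half_sign ((skew ^^ n) y) = half_sign y * birkhoff n (2 * y)"
proof (induction n)
  case (Suc n)
  have "cocycle (2 * (skew ^^ n) y) = cocycle (2 * y - real n * alpha)"
    by (rule cocycle_cong[OF frac_skew_funpow])
  then show ?case using Suc by (simp add: half_sign_skew birkhoff_def)
qed (simp add: birkhoff_def)

text \<open>Twice the displacement is \<open>- n \<alpha>\<close> modulo 1, hence of size at least
  \<open>1 / (4 * n)\<close>; halving gives 1/8.\<close>

lemma skew_displacement:
  assumes "n > 0"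
  shows "1 / 8 \<le> real n * \<bar>(skew ^^ n) y - y\<bar>"
proof -
  have "2 * (skew ^^ n) y - (2 * y - real n * alpha) \<in> \<int>"
    using frac_skew_funpow by (simp add: frac_eq_iff_diff_Ints)
  then obtain m :: int where "2 * (skew ^^ n) y - (2 * y - real n * alpha) = of_int m"
    by (auto elim: Ints_cases)
  then have eq: "2 * ((skew ^^ n) y - y) = - (of_int (int n) * alpha + of_int (- m))" by simp
  have "1 / (4 * real n) \<le> \<bar>2 * ((skew ^^ n) y - y)\<bar>"
    unfolding eq abs_minus_cancel using alpha_badly_approximable[of "int n" "- m"] assms by simp
  also have "\<dots> = 2 * \<bar>(skew ^^ n) y - y\<bar>" unfolding abs_mult by simp
  finally have "1 / (4 * real n) \<le> 2 * \<bar>(skew ^^ n) y - y\<bar>" .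
  then show ?thesis using assms by (simp add: field_simps)
qed

section \<open>Minimality\<close>

lemma chi_locally_constant:
  assumes "frac p \<noteq> 0" "frac p \<noteq> u"
  shows "\<forall>\<^sub>F x in nhds p. chi u x = chi u p"
proof -
  have "isCont frac p" using assms(1) by (intro continuous_frac) simp
  then have lim: "(frac \<longlongrightarrow> frac p) (nhds p)" by (simp add: isCont_def tendsto_at_iff_tendsto_nhds)
  show ?thesis
  proof (cases "frac p < u")
    case True
    show ?thesis using order_tendstoD(2)[OF lim True] by eventually_elim (simp add: chi_def True)
  next
    case False
    then have "u < frac p" using assms(2) by simp
    show ?thesis using order_tendstoD(1)[OF lim \<open>u < frac p\<close>] False
      by (auto simp: chi_def elim!: eventually_mono)
  qed
qed

lemma infinite_even_nat: "infinite {k::nat. even k}"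
  unfolding infinite_nat_iff_unbounded_le by (metis dvd_triv_left le_add2 mem_Collect_eq mult_2)

lemma infinite_odd_nat: "infinite {k::nat. odd k}"
  unfolding infinite_nat_iff_unbounded_le
  by (metis even_Suc dvd_triv_left le_SucI le_add2 mem_Collect_eq mult_2)

lemma cocycle_locally_constant:
  assumes "frac p \<noteq> 0" "\<And>S. infinite S \<Longrightarrow> frac p \<noteq> pos_lim S"
  shows "\<forall>\<^sub>F x in nhds p. cocycle x = cocycle p"
proof -
  have "frac p \<noteq> pos_lim {k. even k}" "frac p \<noteq> pos_lim {k. odd k}" "frac p \<noteq> pos_lim UNIV"
    by (intro assms(2) infinite_even_nat infinite_odd_nat infinite_UNIV_nat)+
  note * = this[THEN chi_locally_constant[OF assms(1)]]
  show ?thesis unfolding cocycle_def using *(1) *(2) *(3) by eventually_elim simp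
qed

lemma chi_at_0:
  assumes "0 < u" "u < 1"
  shows "\<forall>\<^sub>F x in at_left 0. chi u x = 1" "\<forall>\<^sub>F x in at_right 0. chi u x = - 1"
proof -
  have l: "frac x = x + 1" if "- 1 < x" "x < 0" for x :: real
    unfolding frac_unique_iff using that by auto
  have "\<forall>\<^sub>F x in at_left 0. x \<in> {u - 1<..<0}" using assms by (intro eventually_at_left_real) simp
  then show "\<forall>\<^sub>F x in at_left 0. chi u x = 1"
    by eventually_elim (use assms l in \<open>auto simp: chi_def\<close>)
  have r: "frac x = x" if "0 < x" "x < 1" for x :: real
    unfolding frac_unique_iff using that by auto
  have "\<forall>\<^sub>F x in at_right 0. x \<in> {0<..<u}" using assms by (intro eventually_at_right_real) simp
  then show "\<forall>\<^sub>F x in at_right 0. chi u x = - 1"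
    by eventually_elim (use assms r in \<open>auto simp: chi_def\<close>)
qed

lemma cocycle_at_0: "\<forall>\<^sub>F x in at_left 0. cocycle x = 1" "\<forall>\<^sub>F x in at_right 0. cocycle x = - 1"
proof -
  have "0 < pos_lim {k. even k}" "0 < pos_lim {k. odd k}" "0 < pos_lim UNIV"
    by (intro pos_lim_gt_0 infinite_even_nat infinite_odd_nat infinite_UNIV_nat)+
  note l = this[THEN chi_at_0(1)[OF _ pos_lim_lt_1]] and r = this[THEN chi_at_0(2)[OF _ pos_lim_lt_1]]
  show "\<forall>\<^sub>F x in at_left 0. cocycle x = 1"
    unfolding cocycle_def using l(1) l(2) l(3) by eventually_elim simp
  show "\<forall>\<^sub>F x in at_right 0. cocycle x = - 1"
    unfolding cocycle_def using r(1) r(2) r(3) by eventually_elim simp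
qed

text \<open>This is where minimality uses that the three limits are off the orbit of 0.\<close>

lemma cocycle_locally_constant_on_orbit:
  fixes i :: int
  assumes "i \<noteq> 0"
  shows "\<forall>\<^sub>F x in nhds (i * alpha). cocycle x = cocycle (i * alpha)"
proof (rule cocycle_locally_constant)
  show "frac (i * alpha) \<noteq> 0" using alpha_multiple_not_Ints[OF assms] by simp
  show "frac (i * alpha) \<noteq> pos_lim S" if "infinite S" for S
  proof
    assume "frac (i * alpha) = pos_lim S"
    then have "pos_lim S - i * alpha = of_int (- \<lfloor>i * alpha\<rfloor>)" by (simp add: frac_def)
    then show False using pos_lim_not_on_orbit[OF that, of i] by (metis Ints_of_int)
  qed
qed

text \<open>No other discontinuity of the cocycle is on the orbit of 0, so nothing cancels the jump at
  \<open>j \<alpha>\<close> that comes from the discontinuity at 0.\<close>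

lemma birkhoff_jump:
  fixes j n :: nat
  assumes "j < n"
  obtains B where "\<forall>\<^sub>F x in at_left (j * alpha). birkhoff n x = B"
    "\<forall>\<^sub>F x in at_right (j * alpha). birkhoff n x = - B"
proof
  let ?p = "real j * alpha"
  let ?R = "\<lambda>x. \<Prod>i\<in>{..<n} - {j}. cocycle (x - real i * alpha)"
  have split: "birkhoff n x = cocycle (x - ?p) * ?R x" for x
    unfolding birkhoff_def using assms by (intro prod.remove) auto
  have "\<forall>\<^sub>F x in nhds ?p. cocycle (x - real i * alpha) = cocycle (?p - real i * alpha)"
    if "i \<in> {..<n} - {j}" for i
  proof -
    \<comment> \<open>The remaining factors are evaluated near nonzero multiples of
      \<open>alpha\<close>, where they do not jump.\<close>
    have eq: "?p - real i * alpha = of_int (int j - int i) * alpha" by (simp add: algebra_simps)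
    have "filterlim (\<lambda>x. x - real i * alpha) (nhds (?p - real i * alpha)) (nhds ?p)"
      by (intro tendsto_diff tendsto_const) (rule filterlim_ident)
    moreover have "\<forall>\<^sub>F x in nhds (?p - real i * alpha). cocycle x = cocycle (?p - real i * alpha)"
      unfolding eq using that by (intro cocycle_locally_constant_on_orbit) auto
    ultimately show ?thesis unfolding filterlim_iff by blast
  qed
  then have "\<forall>\<^sub>F x in nhds ?p. \<forall>i\<in>{..<n} - {j}. cocycle (x - real i * alpha) = cocycle (?p - real i * alpha)"
    by (intro eventually_ball_finite) auto
  then have R: "\<forall>\<^sub>F x in nhds ?p. ?R x = ?R ?p" by eventually_elim (auto intro: prod.cong)
  have "filterlim (\<lambda>x. x - ?p) (at_left 0) (at_left ?p)"
    unfolding filterlim_at by (auto intro!: tendsto_eq_intros simp: eventually_at_filter)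
  then have "\<forall>\<^sub>F x in at_left ?p. cocycle (x - ?p) = 1"
    using cocycle_at_0(1) unfolding filterlim_iff by blast
  moreover have "\<forall>\<^sub>F x in at_left ?p. ?R x = ?R ?p"
    using R by (rule filter_leD[OF at_within_le_nhds])
  ultimately show "\<forall>\<^sub>F x in at_left ?p. birkhoff n x = ?R ?p"
    by eventually_elim (simp add: split)
  have "filterlim (\<lambda>x. x - ?p) (at_right 0) (at_right ?p)"
    unfolding filterlim_at by (auto intro!: tendsto_eq_intros simp: eventually_at_filter)
  then have "\<forall>\<^sub>F x in at_right ?p. cocycle (x - ?p) = - 1"
    using cocycle_at_0(2) unfolding filterlim_iff by blast
  moreover have "\<forall>\<^sub>F x in at_right ?p. ?R x = ?R ?p"
    using R by (rule filter_leD[OF at_within_le_nhds])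
  ultimately show "\<forall>\<^sub>F x in at_right ?p. birkhoff n x = - ?R ?p"
    by eventually_elim (simp add: split)
qed

lemma frac_in_interval_open:
  fixes u v p :: real
  assumes "0 \<le> u" "frac p \<in> {u<..<v}"
  shows "\<forall>\<^sub>F x in nhds p. frac x \<in> {u<..<v}"
proof -
  have "0 < frac p" using assms by (meson greaterThanLessThan_iff le_less_trans)
  then have "p \<notin> \<int>" unfolding frac_gt_0_iff .
  then have "(frac \<longlongrightarrow> frac p) (nhds p)"
    using continuous_frac by (metis isCont_def tendsto_at_iff_tendsto_nhds)
  then show ?thesis using assms(2)
    by (intro topological_tendstoD) auto
qed

text \<open>A one-sided neighbourhood contains an open interval, which the dense orbit of
  \<open>x\<close> meets modulo 1.\<close>

lemma ex_orbit_hits_eventually: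
  fixes x p :: real
  assumes "(\<forall>\<^sub>F z in at_left p. P z) \<or> (\<forall>\<^sub>F z in at_right p. P z)"
  shows "\<exists>(l::nat) (m::int). P (x - real l * alpha + m)"
proof -
  obtain a b where ab: "a < b" "\<And>z. a < z \<Longrightarrow> z < b \<Longrightarrow> P z"
    using assms by (auto simp: eventually_at_left_field eventually_at_right_field)
  then show ?thesis using ex_alpha_orbit_between[OF \<open>a < b\<close>, of x] by blast
qed

text \<open>If the orbit meets \<open>(u, v)\<close> only with the sign \<open>- t\<close>, then \<open>birkhoff n\<close> is 1 on the orbit points
  that are in \<open>(u, v)\<close> and return there at time \<open>n\<close>. This fails near a jump of \<open>birkhoff n\<close>.\<close>

lemma skew_orbit_hits:
  fixes u v t :: real
  assumes y: "y \<in> {0..<1}" and uv: "0 \<le> u" "u < v" "v \<le> 1" and t: "t \<in> {1, - 1}"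
  shows "\<exists>n. frac (2 * y - real n * alpha) \<in> {u<..<v} \<and> half_sign ((skew ^^ n) y) = t"
proof (rule ccontr)
  assume none: "\<not> ?thesis"
  have miss: "half_sign ((skew ^^ n) y) = - t" if "frac (2 * y - real n * alpha) \<in> {u<..<v}" for n
    using none that half_sign_sign[of "(skew ^^ n) y"] t by auto
  have in_uv: "frac (x + of_int m) \<in> {u<..<v}" if "u < x + of_int m'" "x + of_int m' < v" for x m m'
  proof -
    have "frac (x + of_int m') = x + of_int m'" unfolding frac_eq using that uv by simp
    then show ?thesis using that unfolding frac_add_of_int_right by simp
  qed
  \<comment> \<open>With \<open>- i \<alpha>\<close> and \<open>j \<alpha>\<close> both in
    \<open>(u, v)\<close> modulo 1, the point \<open>j \<alpha>\<close> returns to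
    \<open>(u, v)\<close> at time \<open>j + i\<close>, and \<open>birkhoff (j + i)\<close> jumps at
    it because \<open>j < j + i\<close>.\<close>
  obtain i m where i: "0 < i" "u < 0 - real i * alpha + of_int m" "0 - real i * alpha + of_int m < v"
    using ex_alpha_orbit_between[OF uv(2), of 0] by blast
  have fi: "frac (- (real i * alpha)) \<in> {u<..<v}" using in_uv[of "- (real i * alpha)" m 0] i by simp
  obtain j :: nat where fj: "frac (real j * alpha) \<in> {u<..<v}"
  proof -
    obtain j m where j: "1 - v < 0 - real j * alpha + of_int m" "0 - real j * alpha + of_int m < 1 - u"
      using ex_alpha_orbit_between[of "1 - v" "1 - u" 0] uv by auto
    then have "frac (real j * alpha) \<in> {u<..<v}"
      using in_uv[of "real j * alpha" "1 - m" 0] by simp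
    then show ?thesis using that by blast
  qed
  let ?p = "real j * alpha" and ?n = "j + i"
  have "j < ?n" using i by simp
  then obtain B where B: "\<forall>\<^sub>F x in at_left ?p. birkhoff ?n x = B"
    "\<forall>\<^sub>F x in at_right ?p. birkhoff ?n x = - B" by (rule birkhoff_jump)
  have "?p - real ?n * alpha = - (real i * alpha)" by (simp add: algebra_simps)
  then have "frac (?p - real ?n * alpha) \<in> {u<..<v}" using fi by simp
  then have "\<forall>\<^sub>F x in nhds (?p - real ?n * alpha). frac x \<in> {u<..<v}"
    by (rule frac_in_interval_open[OF uv(1)])
  moreover have "filterlim (\<lambda>x. x - real ?n * alpha) (nhds (?p - real ?n * alpha)) (nhds ?p)"
    by (intro tendsto_diff tendsto_const) (rule filterlim_ident)
  ultimately have "\<forall>\<^sub>F x in nhds ?p. frac (x - real ?n * alpha) \<in> {u<..<v}"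
    unfolding filterlim_iff by blast
  with frac_in_interval_open[OF uv(1) fj]
  have uv_ev: "\<forall>\<^sub>F x in nhds ?p. frac x \<in> {u<..<v} \<and> frac (x - real ?n * alpha) \<in> {u<..<v}"
    by eventually_elim simp
  \<comment> \<open>The orbit of \<open>2 * y\<close> comes close to \<open>?p\<close> from the
    given side at some time \<open>l\<close> and is in \<open>(u, v)\<close> again at time
    \<open>l + ?n\<close>. The sign is \<open>- t\<close> both times, so the product in between is
    1. For \<open>B\<close> and \<open>- B\<close> this is contradictory.\<close>
  have "C = 1" if C: "(\<forall>\<^sub>F x in at_left ?p. birkhoff ?n x = C) \<or> (\<forall>\<^sub>F x in at_right ?p. birkhoff ?n x = C)" for C
  proof -
    have "(\<forall>\<^sub>F x in at_left ?p. birkhoff ?n x = C \<and> frac x \<in> {u<..<v} \<and> frac (x - real ?n * alpha) \<in> {u<..<v}) \<or>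
        (\<forall>\<^sub>F x in at_right ?p. birkhoff ?n x = C \<and> frac x \<in> {u<..<v} \<and> frac (x - real ?n * alpha) \<in> {u<..<v})"
      using C filter_leD[OF at_within_le_nhds uv_ev] by (auto intro: eventually_conj)
    then obtain l m where lm: "birkhoff ?n (2 * y - real l * alpha + of_int m) = C"
      "frac (2 * y - real l * alpha + of_int m) \<in> {u<..<v}"
      "frac (2 * y - real l * alpha + of_int m - real ?n * alpha) \<in> {u<..<v}"
      using ex_orbit_hits_eventually[of _ ?p "2 * y"] by blast
    let ?x = "2 * y - real l * alpha"
    have "frac (?x + of_int m) = frac ?x" by simp
    note C' = birkhoff_cong[OF this, of ?n] and sh = frac_diff_cong[OF this, of "real ?n * alpha"]
    have 1: "half_sign ((skew ^^ l) y) = - t" by (rule miss) (use lm(2) in simp)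
    have "?x - real ?n * alpha = 2 * y - real (l + ?n) * alpha" by (simp add: algebra_simps)
    then have "frac (2 * y - real (l + ?n) * alpha) \<in> {u<..<v}" using lm(3) unfolding sh by (simp only:)
    then have "half_sign ((skew ^^ (l + ?n)) y) = - t" by (rule miss)
    then have "half_sign y * birkhoff l (2 * y) * birkhoff ?n ?x = - t"
      unfolding half_sign_skew_funpow birkhoff_add by (simp only: mult.assoc)
    then have "- t * birkhoff ?n ?x = - t" using 1 unfolding half_sign_skew_funpow by simp
    then show "C = 1" using t lm(1) C' by auto
  qed
  from this[of B] this[of "- B"] show False using B by auto
qed

lemma skew_minimal: "minimal_map skew"
  unfolding minimal_map_def
proof (intro ballI subsetI)
  fix y z :: real
  assume y: "y \<in> {0..<1}" and z: "z \<in> {0..<1}"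
  show "z \<in> closure {int_iterate skew n y |n. n \<in> UNIV}"
    unfolding closure_approachable
  proof (intro allI impI)
    fix e :: real assume "0 < e"
    let ?u = "frac (2 * z)"
    \<comment> \<open>A right neighbourhood of \<open>?u\<close> suffices; cutting it off at 1 keeps
      it from wrapping around.\<close>
    let ?v = "min 1 (?u + e)"
    have "?u < 1" by (rule frac_lt_1)
    then obtain n where n: "frac (2 * y - real n * alpha) \<in> {?u<..<?v}"
      "half_sign ((skew ^^ n) y) = half_sign z"
      using skew_orbit_hits[OF y, of ?u ?v "half_sign z"] half_sign_sign[of z] \<open>0 < e\<close> by auto
    have "(skew ^^ n) y = frac (2 * y - real n * alpha) / 2 + (1 - half_sign z) / 4"
      using encode_eqI[OF skew_funpow_in[OF y] frac_skew_funpow n(2)] by (simp add: encode_def)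
    moreover have "z = ?u / 2 + (1 - half_sign z) / 4"
      using encode_double[OF z] by (simp add: encode_def)
    ultimately have "(skew ^^ n) y - z = (frac (2 * y - real n * alpha) - ?u) / 2" by argo
    then have "dist ((skew ^^ n) y) z < e" using n(1) \<open>0 < e\<close> by (auto simp: dist_real_def)
    moreover have "int_iterate skew (int n) y = (skew ^^ n) y" by (simp add: int_iterate_def)
    ultimately show "\<exists>x\<in>{int_iterate skew n y |n. n \<in> UNIV}. dist x z < e"
      by (metis (mono_tags, lifting) UNIV_I mem_Collect_eq)
  qed
qed

section \<open>Invariant measures\<close>

abbreviation unit_lebesgue :: "real measure" where
  "unit_lebesgue \<equiv> restrict_space lborel {0..<1}"

lemma sets_unit_lebesgue: "sets unit_lebesgue = sets (restrict_space borel {0..<1})"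
  by (simp add: sets_restrict_space)

lemma space_unit_lebesgue [simp]: "space unit_lebesgue = {0..<1}"
  by (simp add: space_restrict_space)

lemma emeasure_unit_lebesgue: "A \<subseteq> {0..<1} \<Longrightarrow> emeasure unit_lebesgue A = emeasure lborel A"
  by (simp add: emeasure_restrict_space)

lemma sets_unit_lebesgueI: "A \<in> sets borel \<Longrightarrow> A \<subseteq> {0..<1} \<Longrightarrow> A \<in> sets unit_lebesgue"
  by (simp add: sets_restrict_space_iff)

lemma prob_space_unit_lebesgue: "prob_space unit_lebesgue"
  by (rule prob_spaceI) (simp add: emeasure_restrict_space)

lemma borel_measurable_frac [measurable]: "(frac :: real \<Rightarrow> real) \<in> borel_measurable borel"
  unfolding frac_def[abs_def] by measurable

lemma measurable_rotation:
  "(\<lambda>x. frac (x - t)) \<in> measurable unit_lebesgue unit_lebesgue"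
proof (rule measurable_restrict_space2)
  show "(\<lambda>x. frac (x - t)) \<in> space unit_lebesgue \<rightarrow> {0..<1}" by (auto simp: frac_lt_1)
  show "(\<lambda>x. frac (x - t)) \<in> measurable unit_lebesgue lborel"
    by (rule measurable_restrict_space1) measurable
qed

lemma emeasure_lborel_shift:
  fixes c :: real
  assumes "B \<in> sets borel"
  shows "{x. x - c \<in> B} \<in> sets borel" "emeasure lborel {x. x - c \<in> B} = emeasure lborel B"
proof -
  have [measurable]: "B \<in> sets borel" by fact
  have eq: "(+) (- c) -` B \<inter> space lborel = {x. x - c \<in> B}" by auto
  show "{x. x - c \<in> B} \<in> sets borel" by measurable
  show "emeasure lborel {x. x - c \<in> B} = emeasure lborel B"
    using emeasure_distr[of "(+) (- c)" lborel borel B] assms unfolding eq lborel_distr_plus by simp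
qed

text \<open>The preimage of \<open>A\<close> consists of translates of the parts of \<open>A\<close>
  to the left and right of \<open>1 - f\<close>, and these translates are disjoint.\<close>

lemma rotation_invariant: "distr unit_lebesgue unit_lebesgue (\<lambda>x. frac (x - t)) = unit_lebesgue"
proof (rule measure_eqI)
  fix A assume "A \<in> sets (distr unit_lebesgue unit_lebesgue (\<lambda>x. frac (x - t)))"
  then have A: "A \<in> sets unit_lebesgue" by simp
  then have A': "A \<in> sets borel" "A \<subseteq> {0..<1}" by (auto simp: sets_restrict_space_iff)
  define f where "f = frac t"
  have f: "0 \<le> f" "f < 1" by (auto simp: f_def frac_lt_1)
  let ?B = "A \<inter> {0..<1 - f}" and ?C = "A \<inter> {1 - f..<1}"
  have BC: "?B \<in> sets borel" "?C \<in> sets borel" using A' by auto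
  have fr: "frac (x - t) = (if f \<le> x then x - f else x - (f - 1))" if "x \<in> {0..<1}" for x
  proof -
    have "x - t - (if f \<le> x then x - f else x - (f - 1)) \<in> \<int>" by (simp add: f_def frac_def)
    then show ?thesis unfolding frac_unique_iff using that f by auto
  qed
  have eq: "(\<lambda>x. frac (x - t)) -` A \<inter> {0..<1} = {x. x - f \<in> ?B} \<union> {x. x - (f - 1) \<in> ?C}"
    (is "?L = ?R")
  proof
    show "?L \<subseteq> ?R" using fr A'(2) f by (auto split: if_splits)
    show "?R \<subseteq> ?L" using fr f by auto
  qed
  have "emeasure (distr unit_lebesgue unit_lebesgue (\<lambda>x. frac (x - t))) A = emeasure lborel ?L"
    using A measurable_rotation by (simp add: emeasure_distr emeasure_unit_lebesgue)
  also have "\<dots> = emeasure lborel {x. x - f \<in> ?B} + emeasure lborel {x. x - (f - 1) \<in> ?C}"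
    unfolding eq
  proof (rule plus_emeasure[symmetric])
    show "{x. x - f \<in> ?B} \<in> sets lborel" "{x. x - (f - 1) \<in> ?C} \<in> sets lborel"
      using emeasure_lborel_shift(1)[OF BC(1)] emeasure_lborel_shift(1)[OF BC(2)] by (simp_all only: sets_lborel)
  qed auto
  also have "\<dots> = emeasure lborel ?B + emeasure lborel ?C"
    using BC by (simp only: emeasure_lborel_shift(2))
  also have "\<dots> = emeasure lborel (?B \<union> ?C)" using BC by (intro plus_emeasure) auto
  also have "?B \<union> ?C = A" using A'(2) by auto
  finally show "emeasure (distr unit_lebesgue unit_lebesgue (\<lambda>x. frac (x - t))) A = emeasure unit_lebesgue A"
    using A'(2) by (simp add: emeasure_unit_lebesgue)
qed simp

lemma AE_rotation:
  assumes "AE x in unit_lebesgue. P x"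
  shows "AE x in unit_lebesgue. P (frac (x - t))"
  by (rule AE_distrD[OF measurable_rotation]) (use assms in \<open>simp only: rotation_invariant\<close>)

section \<open>Approximation of the cocycle by coboundaries\<close>

definition same :: "nat \<Rightarrow> nat set" where "same k = {j. even j = even k}"
definition other :: "nat \<Rightarrow> nat set" where "other k = {j. even j \<noteq> even k}"

text \<open>At step \<open>k\<close> two of the three discontinuities \<open>pos {k. even k}\<close>, \<open>pos {k. odd k}\<close>, \<open>pos UNIV\<close>
  move to the right by \<open>\<delta>\<^sub>k\<close>: the one that belongs to the parity of \<open>k\<close>, and \<open>pos UNIV\<close>. They differ
  by the third, which is congruent to \<open>m \<alpha>\<close> with \<open>m = mult_of_pos (other k) k\<close>, so the two
  changes together are the coboundary of the tower of height \<open>m\<close> over an interval of length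
  \<open>\<delta>\<^sub>k\<close>, and \<open>m \<delta>\<^sub>k\<close> is summable.\<close>

definition pulse :: "nat \<Rightarrow> real \<Rightarrow> real" where
  "pulse k x = chi (pos (same k) k) x * chi (pos (same k) (Suc k)) x"

definition tower :: "nat \<Rightarrow> real \<Rightarrow> real" where
  "tower k x = (\<Prod>j<mult_of_pos (other k) k. pulse k (x - real j * alpha))"

definition approx_transfer :: "nat \<Rightarrow> real \<Rightarrow> real" where
  "approx_transfer n x = (\<Prod>k<n. tower k x)"

definition approx_cocycle :: "nat \<Rightarrow> real \<Rightarrow> real" where
  "approx_cocycle n x = chi (pos {k. even k} n) x * chi (pos {k. odd k} n) x * chi (pos UNIV n) x"

text \<open>The eventual value of \<open>approx_transfer n x\<close>; the default \<open>- 1\<close>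
  where there is none keeps it a sign everywhere.\<close>

definition transfer :: "real \<Rightarrow> real" where
  "transfer x = (if \<forall>\<^sub>F n in sequentially. approx_transfer n x = 1 then 1 else - 1)"

lemma pos_nonneg: "0 \<le> pos S k"
  unfolding pos_def by (intro sum_nonneg) (simp add: less_imp_le[OF delta_gt_0])

lemma pos_lt_1: "pos S k < 1"
  using pos_le_pos_lim[of S k] pos_lim_lt_1[of S] by linarith

lemma pos_same_other: "pos (same k) n + pos (other k) n = pos UNIV n"
  unfolding pos_def sum.distrib[symmetric] by (intro sum.cong) (auto simp: same_def other_def)

lemma pos_same_Suc: "pos (same k) (Suc k) = pos (same k) k + delta k"
  by (simp add: pos_Suc same_def)

lemma pos_other_Suc: "pos (other k) (Suc k) = pos (other k) k"
  by (simp add: pos_Suc other_def)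

lemma pulse_cong: "frac x = frac y \<Longrightarrow> pulse k x = pulse k y"
  unfolding pulse_def by (metis chi_cong)

lemma pulse_square: "pulse k x * pulse k x = 1"
  by (auto simp: pulse_def chi_def)

lemma pulse_sign: "pulse k x \<in> {1, - 1}"
  unfolding pulse_def by (intro sign_mult chi_sign)

text \<open>Modulo 1 the shift is by \<open>pos (other k) k\<close>, which carries the interval of
  the pulse to the one between \<open>pos UNIV k\<close> and \<open>pos UNIV (Suc k)\<close>. The
  latter ends before 1, so nothing wraps around.\<close>

lemma pulse_shift:
  "pulse k (x - mult_of_pos (other k) k * alpha) = chi (pos UNIV k) x * chi (pos UNIV (Suc k)) x"
proof -
  let ?b = "pos (other k) k"
  have "x - ?b - (x - mult_of_pos (other k) k * alpha) \<in> \<int>"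
    using mult_of_pos[of "other k" k] by simp
  then have "frac (x - ?b) = frac (x - mult_of_pos (other k) k * alpha)"
    by (simp only: frac_eq_iff_diff_Ints)
  then have "pulse k (x - mult_of_pos (other k) k * alpha) = pulse k (x - ?b)"
    by (metis pulse_cong)
  also have "\<dots> = chi (pos UNIV k) x * chi (pos UNIV (Suc k)) x"
  proof -
    have U: "pos UNIV k = pos (same k) k + ?b" "pos UNIV (Suc k) = pos (same k) (Suc k) + ?b"
      using pos_same_other[of k k] pos_same_other[of k "Suc k"] pos_other_Suc[of k] by auto
    have lt: "pos (same k) (Suc k) + ?b < 1" using pos_lt_1[of UNIV "Suc k"] U by simp
    have b: "0 \<le> ?b" "?b < 1" by (rule pos_nonneg, rule pos_lt_1)
    have mono: "pos (same k) k \<le> pos (same k) (Suc k)" "0 \<le> pos (same k) k"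
      using delta_gt_0[of k] by (auto simp: pos_same_Suc pos_nonneg)
    have x: "0 \<le> frac x" "frac x < 1" by (auto simp: frac_lt_1)
    have "frac (x - ?b) = frac x - ?b + (if frac x < ?b then 1 else 0)"
    proof -
      have "x - ?b - (frac x - ?b + (if frac x < ?b then 1 else 0)) \<in> \<int>" by (simp add: frac_def)
      then show ?thesis unfolding frac_unique_iff using b x by (simp del: frac_ge_0)
    qed
    then show ?thesis unfolding pulse_def chi_def U using b x mono lt by (auto simp del: frac_ge_0)
  qed
  finally show ?thesis .
qed

lemma tower_cong: "frac x = frac y \<Longrightarrow> tower k x = tower k y"
  unfolding tower_def by (intro prod.cong refl pulse_cong frac_diff_cong)

lemma tower_sign: "tower k x \<in> {1, - 1}"
proof -
  have "(\<Prod>j<m. pulse k (x - real j * alpha)) \<in> {1, - 1}" for m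
    by (induction m) (use sign_mult[OF _ pulse_sign] in \<open>auto simp del: insert_iff\<close>)
  then show ?thesis unfolding tower_def .
qed

text \<open>The two products share all inner factors, and these square to 1.\<close>

lemma prod_telescope_rotation:
  fixes p :: "real \<Rightarrow> real"
  assumes "\<And>x. p x * p x = 1"
  shows "(\<Prod>j<m. p (x - real j * t)) * (\<Prod>j<m. p (x - t - real j * t)) = p x * p (x - real m * t)"
proof (induction m)
  case 0
  show ?case by (simp add: assms)
next
  case (Suc m)
  have eq: "x - t - real m * t = x - real (Suc m) * t" by (simp add: algebra_simps)
  have "(\<Prod>j<Suc m. p (x - real j * t)) * (\<Prod>j<Suc m. p (x - t - real j * t)) =
      ((\<Prod>j<m. p (x - real j * t)) * (\<Prod>j<m. p (x - t - real j * t))) *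
      (p (x - real m * t) * p (x - real (Suc m) * t))"
    unfolding prod.lessThan_Suc eq by (simp only: ac_simps)
  also have "\<dots> = p x * (p (x - real m * t) * p (x - real m * t)) * p (x - real (Suc m) * t)"
    unfolding Suc by (simp only: ac_simps)
  finally show ?case unfolding assms by simp
qed

lemma tower_coboundary:
  "tower k x * tower k (x - alpha) = pulse k x * (chi (pos UNIV k) x * chi (pos UNIV (Suc k)) x)"
  unfolding tower_def pulse_shift[symmetric]
  by (rule prod_telescope_rotation) (rule pulse_square)

text \<open>Only the factors for the parity of \<open>k\<close> and for \<open>UNIV\<close> move,
  and multiplying by old value times new value replaces a sign by its successor.\<close>

lemma approx_cocycle_Suc:
  "approx_cocycle (Suc k) x =
    approx_cocycle k x * (pulse k x * (chi (pos UNIV k) x * chi (pos UNIV (Suc k)) x))"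
proof (cases "even k")
  case True
  then have "same k = {j. even j}" by (auto simp: same_def)
  moreover have "pos {j. odd j} (Suc k) = pos {j. odd j} k" using True by (simp add: pos_Suc)
  ultimately show ?thesis unfolding approx_cocycle_def pulse_def by (simp add: chi_def)
next
  case False
  then have "same k = {j. odd j}" by (auto simp: same_def)
  moreover have "pos {j. even j} (Suc k) = pos {j. even j} k" using False by (simp add: pos_Suc)
  ultimately show ?thesis unfolding approx_cocycle_def pulse_def by (simp add: chi_def)
qed

lemma approx_cocycle_coboundary:
  "approx_cocycle n x = approx_transfer n x * approx_transfer n (x - alpha)"
proof (induction n)
  case 0
  \<comment> \<open>All partial sums start at 0, and \<open>chi 0\<close> is constantly 1.\<close>
  have "\<not> frac x < 0" using frac_ge_0[of x] by linarith
  then show ?case by (simp add: approx_cocycle_def approx_transfer_def chi_def)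
next
  case (Suc n)
  then show ?case
    unfolding approx_cocycle_Suc tower_coboundary[symmetric]
    by (simp add: approx_transfer_def)
qed

text \<open>The partial sums approach the limit from below and \<open>chi\<close> compares strictly,
  so this holds at every point, the endpoint included.\<close>

lemma eventually_chi_pos: "\<forall>\<^sub>F n in sequentially. chi (pos S n) x = chi (pos_lim S) x"
proof (cases "frac x < pos_lim S")
  case True
  from order_tendstoD(1)[OF pos_tendsto True] show ?thesis
    by eventually_elim (simp add: chi_def True)
next
  case False
  then have "\<not> frac x < pos S n" for n using pos_le_pos_lim[of S n] by linarith
  then show ?thesis using False by (simp add: chi_def)
qed

lemma eventually_approx_cocycle: "\<forall>\<^sub>F n in sequentially. approx_cocycle n x = cocycle x"
  using eventually_chi_pos[of "{k. even k}" x] eventually_chi_pos[of "{k. odd k}" x]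
    eventually_chi_pos[of UNIV x]
  by eventually_elim (simp add: approx_cocycle_def cocycle_def)

lemma eventually_approx_transfer:
  assumes "\<forall>\<^sub>F k in sequentially. tower k x = 1"
  shows "\<forall>\<^sub>F n in sequentially. approx_transfer n x = transfer x"
proof -
  obtain n0 where n0: "\<And>k. k \<ge> n0 \<Longrightarrow> tower k x = 1"
    using assms by (auto simp: eventually_sequentially)
  have "approx_transfer n x = approx_transfer n0 x" if "n \<ge> n0" for n
    using that by (induction n rule: dec_induct) (auto simp: approx_transfer_def n0)
  then have const: "\<forall>\<^sub>F n in sequentially. approx_transfer n x = approx_transfer n0 x"
    unfolding eventually_sequentially by blast
  have "approx_transfer n x \<in> {1, - 1}" for n
    unfolding approx_transfer_def
    by (induction n) (use sign_mult[OF _ tower_sign] in \<open>auto simp del: insert_iff\<close>)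
  then consider "approx_transfer n0 x = 1" | "approx_transfer n0 x = - 1" by blast
  then have "transfer x = approx_transfer n0 x"
  proof cases
    case 2
    have "\<not> (\<forall>\<^sub>F n in sequentially. approx_transfer n x = 1)"
    proof
      assume "\<forall>\<^sub>F n in sequentially. approx_transfer n x = 1"
      with const have "\<forall>\<^sub>F n in sequentially. False" by eventually_elim (use 2 in simp)
      then show False by simp
    qed
    then show ?thesis by (simp add: transfer_def 2)
  qed (use const in \<open>simp add: transfer_def\<close>)
  then show ?thesis using const by simp
qed

section \<open>Measurability and almost everywhere convergence\<close>

lemma borel_measurable_chi [measurable]: "chi u \<in> borel_measurable borel"
  unfolding chi_def[abs_def] by measurable

lemma borel_measurable_pulse [measurable]: "pulse k \<in> borel_measurable borel"
  unfolding pulse_def[abs_def] by measurable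

lemma borel_measurable_tower [measurable]: "tower k \<in> borel_measurable borel"
  unfolding tower_def[abs_def] by measurable

lemma borel_measurable_approx_transfer [measurable]: "approx_transfer n \<in> borel_measurable borel"
  unfolding approx_transfer_def[abs_def] by measurable

lemma borel_measurable_transfer [measurable]: "transfer \<in> borel_measurable borel"
  unfolding transfer_def[abs_def] eventually_sequentially by measurable

text \<open>Up to a rotation the set lies in an interval of length \<open>delta k\<close>.\<close>

lemma emeasure_pulse_le:
  "emeasure unit_lebesgue {x \<in> {0..<1}. pulse k (x - t) \<noteq> 1} \<le> ennreal (delta k)"
proof -
  let ?A = "{x \<in> {0..<1}. pulse k x \<noteq> 1}"
  have A: "?A \<in> sets unit_lebesgue"
    by (rule sets_unit_lebesgueI) (measurable, auto)
  have "{x \<in> {0..<1}. pulse k (x - t) \<noteq> 1} = (\<lambda>x. frac (x - t)) -` ?A \<inter> space unit_lebesgue"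
    using pulse_cong[of "frac (_ - t)" "_ - t"] by (auto simp: frac_lt_1)
  then have "emeasure unit_lebesgue {x \<in> {0..<1}. pulse k (x - t) \<noteq> 1} =
      emeasure (distr unit_lebesgue unit_lebesgue (\<lambda>x. frac (x - t))) ?A"
    using emeasure_distr[OF measurable_rotation A] by simp
  also have "\<dots> = emeasure lborel ?A"
    unfolding rotation_invariant by (rule emeasure_unit_lebesgue) auto
  also have "\<dots> \<le> emeasure lborel {pos (same k) k..<pos (same k) k + delta k}"
  proof (rule emeasure_mono)
    show "?A \<subseteq> {pos (same k) k..<pos (same k) k + delta k}"
      using delta_gt_0[of k]
      by (auto simp: pulse_def chi_def pos_same_Suc frac_eq split: if_splits)
  qed simp
  also have "\<dots> = ennreal (delta k)" using delta_gt_0[of k] by simp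
  finally show ?thesis .
qed

lemma AE_eventually_tower: "AE x in unit_lebesgue. \<forall>\<^sub>F k in sequentially. tower k x = 1"
proof -
  let ?A = "\<lambda>k. {x \<in> {0..<1}. tower k x \<noteq> 1}"
  have A: "?A k \<in> sets unit_lebesgue" for k by (rule sets_unit_lebesgueI) (measurable, auto)
  have le: "emeasure unit_lebesgue (?A k) \<le> ennreal (alpha ^ k)" for k
  proof -
    let ?m = "mult_of_pos (other k) k"
    let ?B = "\<lambda>j. {x \<in> {0..<1}. pulse k (x - real j * alpha) \<noteq> 1}"
    have B: "?B j \<in> sets unit_lebesgue" for j by (rule sets_unit_lebesgueI) (measurable, auto)
    \<comment> \<open>A product different from 1 has a factor different from 1.\<close>
    have "?A k \<subseteq> (\<Union>j<?m. ?B j)" unfolding tower_def by (auto intro: prod.neutral ccontr)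
    then have "emeasure unit_lebesgue (?A k) \<le> emeasure unit_lebesgue (\<Union>j<?m. ?B j)"
      using B by (intro emeasure_mono) auto
    also have "\<dots> \<le> (\<Sum>j<?m. emeasure unit_lebesgue (?B j))"
      using B by (intro emeasure_subadditive_finite) auto
    also have "\<dots> \<le> (\<Sum>j<?m. ennreal (delta k))" by (intro sum_mono emeasure_pulse_le)
    also have "\<dots> = ennreal (?m * delta k)"
      using delta_gt_0[of k] by (simp add: ennreal_mult' flip: ennreal_of_nat_eq_real_of_nat)
    also have "\<dots> \<le> ennreal (alpha ^ k)" by (intro ennreal_leI mult_of_pos_times_delta_le)
    finally show ?thesis .
  qed
  interpret prob_space unit_lebesgue by (rule prob_space_unit_lebesgue)
  have "summable (\<lambda>k. alpha ^ k)" using alpha_gt_0 alpha_lt_half by (intro summable_geometric) simp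
  moreover have "norm (measure unit_lebesgue (?A k)) \<le> alpha ^ k" for k
    using le[of k] alpha_gt_0 by (simp add: emeasure_eq_measure)
  ultimately have sum: "summable (\<lambda>k. measure unit_lebesgue (?A k))"
    by (rule summable_comparison_test'[of _ 0])
  have "AE x in unit_lebesgue. \<forall>\<^sub>F k in sequentially. x \<in> space unit_lebesgue - ?A k"
    by (rule borel_cantelli_AE1[OF A _ sum]) (simp add: emeasure_eq_measure)
  then show ?thesis by eventually_elim (auto elim: eventually_mono)
qed

lemma transfer_sign: "transfer x \<in> {1, - 1}" by (simp add: transfer_def)

lemma transfer_cong:
  assumes "frac x = frac y" shows "transfer x = transfer y"
  using tower_cong[OF assms] by (simp add: transfer_def approx_transfer_def)

text \<open>For almost every \<open>x\<close> the towers are eventually trivial at both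
  \<open>x\<close> and \<open>x - alpha\<close>, so the finite coboundary identities pass to the
  eventual values.\<close>

lemma AE_cocycle_coboundary: "AE x in unit_lebesgue. cocycle x * transfer x = transfer (x - alpha)"
  using AE_eventually_tower AE_rotation[OF AE_eventually_tower, of alpha]
proof eventually_elim
  case (elim x)
  then have "\<forall>\<^sub>F k in sequentially. tower k (x - alpha) = 1"
    using tower_cong[of "frac (x - alpha)" "x - alpha"] by simp
  then have "\<forall>\<^sub>F n in sequentially. approx_transfer n (x - alpha) = transfer (x - alpha)"
    by (rule eventually_approx_transfer)
  with eventually_approx_transfer[OF elim(1)] eventually_approx_cocycle[of x]
  have "\<forall>\<^sub>F n in sequentially. cocycle x = transfer x * transfer (x - alpha)"
    by eventually_elim (simp add: approx_cocycle_coboundary)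
  then have "cocycle x = transfer x * transfer (x - alpha)" unfolding eventually_const_iff by simp
  moreover have "transfer x * transfer x = 1" using transfer_sign[of x] by fastforce
  moreover have "transfer x * transfer (x - alpha) * transfer x =
      transfer x * transfer x * transfer (x - alpha)" by (simp only: ac_simps)
  ultimately show ?case by (simp only: mult_1)
qed

text \<open>Almost everywhere \<open>cocycle\<close> is a coboundary, so the graphs of \<open>transfer\<close> and of
  \<open>- transfer\<close> each carry an invariant lift of Lebesgue measure.\<close>

definition graph_measure :: "real \<Rightarrow> real measure" where
  "graph_measure e =
    distr unit_lebesgue (restrict_space borel {0..<1}) (\<lambda>x. encode x (e * transfer x))"

lemma measurable_graph:
  assumes "e \<in> {1, - 1}"
  shows "(\<lambda>x. encode x (e * transfer x)) \<in> measurable unit_lebesgue (restrict_space borel {0..<1})"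
proof (rule measurable_restrict_space2)
  show "(\<lambda>x. encode x (e * transfer x)) \<in> space unit_lebesgue \<rightarrow> {0..<1}"
    using encode_in[OF sign_mult[OF assms transfer_sign]] by blast
  show "(\<lambda>x. encode x (e * transfer x)) \<in> borel_measurable unit_lebesgue"
    unfolding encode_def by (rule measurable_restrict_space1) measurable
qed

lemma measurable_skew:
  "skew \<in> measurable (restrict_space borel {0..<1}) (restrict_space borel {0..<1})"
proof (rule measurable_restrict_space2)
  show "skew \<in> space (restrict_space borel {0..<1}) \<rightarrow> {0..<1}" using skew_in by blast
  show "skew \<in> borel_measurable (restrict_space borel {0..<1})"
    unfolding skew_def[abs_def] encode_def half_sign_def cocycle_def
    by (rule measurable_restrict_space1) measurable
qed

text \<open>The parametrization of the graph intertwines the rotation with \<open>skew\<close>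
  almost everywhere, so the measure inherits the invariance of Lebesgue measure.\<close>

lemma invariant_graph_measure:
  assumes e: "e \<in> {1, - 1}"
  shows "invariant_borel_prob skew (graph_measure e)"
  unfolding invariant_borel_prob_def
proof (intro conjI)
  let ?g = "\<lambda>x. encode x (e * transfer x)" and ?S = "restrict_space borel {0..<1::real}"
  note g = measurable_graph[OF e]
  show "prob_space (graph_measure e)"
    unfolding graph_measure_def by (rule prob_space.prob_space_distr[OF prob_space_unit_lebesgue g])
  show sets: "sets (graph_measure e) = sets ?S" by (simp add: graph_measure_def)
  show "skew \<in> measurable (graph_measure e) (graph_measure e)"
    using measurable_skew measurable_cong_sets[OF sets sets] by blast
  have "distr (graph_measure e) (graph_measure e) skew = distr (graph_measure e) ?S skew"
    by (rule distr_cong) (simp_all add: sets)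
  also have "\<dots> = distr unit_lebesgue ?S (skew \<circ> ?g)"
    unfolding graph_measure_def by (rule distr_distr[OF measurable_skew g])
  also have "\<dots> = distr unit_lebesgue ?S (?g \<circ> (\<lambda>x. frac (x - alpha)))"
  proof (rule distr_cong_AE)
    show "AE x in unit_lebesgue. (skew \<circ> ?g) x = (?g \<circ> (\<lambda>x. frac (x - alpha))) x"
      using AE_cocycle_coboundary
    proof eventually_elim
      case (elim x)
      have "skew (?g x) = encode (x - alpha) (e * transfer x * cocycle x)"
        by (rule skew_encode[OF sign_mult[OF e transfer_sign]])
      also have "e * transfer x * cocycle x = e * transfer (frac (x - alpha))"
        using elim transfer_cong[of "frac (x - alpha)" "x - alpha"] by (simp add: ac_simps)
      finally show ?case by (simp add: encode_def)
    qed
    show "skew \<circ> ?g \<in> measurable unit_lebesgue ?S" by (rule measurable_comp[OF g measurable_skew])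
    show "?g \<circ> (\<lambda>x. frac (x - alpha)) \<in> measurable unit_lebesgue ?S"
      by (rule measurable_comp[OF measurable_rotation g])
  qed simp_all
  also have "\<dots> = distr (distr unit_lebesgue unit_lebesgue (\<lambda>x. frac (x - alpha))) ?S ?g"
    by (rule distr_distr[OF g measurable_rotation, symmetric])
  also have "\<dots> = graph_measure e" unfolding rotation_invariant graph_measure_def ..
  finally show "distr (graph_measure e) (graph_measure e) skew = graph_measure e" .
qed

lemma graph_measure_neq: "graph_measure 1 \<noteq> graph_measure (- 1)"
proof
  assume eq: "graph_measure 1 = graph_measure (- 1)"
  \<comment> \<open>The encoded graph of \<open>transfer\<close>: it has full measure for the sign 1
    and measure 0 for the sign \<open>- 1\<close>.\<close>
  let ?A = "{y \<in> {0..<1}. half_sign y = transfer (2 * y)}"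
  have A: "?A \<in> sets (restrict_space borel {0..<1})"
    unfolding sets_unit_lebesgue[symmetric] half_sign_def
    by (rule sets_unit_lebesgueI) (measurable, auto)
  have "emeasure (graph_measure e) ?A = (if e = 1 then 1 else 0)" if e: "e \<in> {1, - 1}" for e
  proof -
    have "encode x (e * transfer x) \<in> ?A \<longleftrightarrow> e = 1" for x
    proof -
      note s = sign_mult[OF e transfer_sign[of x]]
      have "transfer (2 * encode x (e * transfer x)) = transfer x"
        by (rule transfer_cong[OF frac_encode[OF s]])
      then show ?thesis
        using encode_in[OF s, of x] half_sign_encode[OF s, of x] transfer_sign[of x] e by auto
    qed
    then have "(\<lambda>x. encode x (e * transfer x)) -` ?A \<inter> {0..<1} = (if e = 1 then {0..<1} else {})"
      by auto
    then show ?thesis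
      unfolding graph_measure_def using emeasure_distr[OF measurable_graph[OF e] A]
      by (simp add: emeasure_unit_lebesgue)
  qed
  from this[of 1] this[of "- 1"] show False unfolding eq by simp
qed

lemma skew_not_uniquely_ergodic: "\<not> uniquely_ergodic skew"
proof
  assume "uniquely_ergodic skew"
  moreover have "invariant_borel_prob skew (graph_measure 1)" "invariant_borel_prob skew (graph_measure (- 1))"
    by (rule invariant_graph_measure, simp)+
  ultimately have "graph_measure 1 = graph_measure (- 1)" unfolding uniquely_ergodic_def by blast
  then show False using graph_measure_neq by blast
qed

theorem corollary1:
  shows "\<exists>(T :: real \<Rightarrow> real) (c :: real).
           interval_exchange T \<and> minimal_map T \<and> \<not> uniquely_ergodic T \<and> c > 0 \<and>
           (\<forall>x\<in>{0..<1}. (INF n\<in>{n::nat. n > 0}. real n * \<bar>(T ^^ n) x - x\<bar>) > c)"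
proof (intro exI conjI ballI)
  show "interval_exchange skew" by (rule skew_interval_exchange)
  show "minimal_map skew" by (rule skew_minimal)
  show "\<not> uniquely_ergodic skew" by (rule skew_not_uniquely_ergodic)
  \<comment> \<open>The infimum is at least 1/8, so a smaller constant gives the strict
    inequality.\<close>
  show "(1/16 :: real) > 0" by simp
  fix x :: real
  have "1/8 \<le> (INF n\<in>{n::nat. n > 0}. real n * \<bar>(skew ^^ n) x - x\<bar>)"
  proof (rule cINF_greatest)
    show "{n::nat. n > 0} \<noteq> {}" by blast
    show "1/8 \<le> real n * \<bar>(skew ^^ n) x - x\<bar>" if "n \<in> {n. n > 0}" for n
      using that skew_displacement by blast
  qed
  then show "(INF n\<in>{n::nat. n > 0}. real n * \<bar>(skew ^^ n) x - x\<bar>) > 1/16" by simp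
qed

end
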